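(* The weak Kalton constant satisfies $K_w\le 26.8$; that is, for every $n\ge2$ and every $\epsilon\ge0$, every weakly $\epsilon$-modular set function over $[n]$ is $26.8\,\epsilon$-linear.
   Context: A set function over $[n]$ is a map $f:2^{[n]}\to\mathbb{R}$. It is weakly $\epsilon$-modular if $|f(S)+f(T)-f(S\cup T)-f(S\cap T)|\le\epsilon$ for all disjoint $S,T\subseteq[n]$. It is linear if there are constants $c_0,\dots,c_n$ with $f(S)=c_0+\sum_{i\in S}c_i$; it is $\Delta$-linear if some linear $\ell$ satisfies $|f(S)-\ell(S)|\le\Delta$ for all $S$. The weak Kalton constant $K_w$ is the smallest constant such that every weakly $\epsilon$-modular set function (over any $[n]$, any $\epsilon\ge0$) is $K_w\epsilon$-linear. *)

theory Defs
  imports "HOL-Analysis.Analysis"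
begin

(* A set function over [n] is any f :: nat set => real; only its values on subsets of {1..n}
   matter. *)

definition weakly_modular :: "nat \<Rightarrow> real \<Rightarrow> (nat set \<Rightarrow> real) \<Rightarrow> bool" where
  "weakly_modular n \<epsilon> f \<longleftrightarrow>
     (\<forall>S T. S \<subseteq> {1..n} \<and> T \<subseteq> {1..n} \<and> S \<inter> T = {} \<longrightarrow>
        \<bar>f S + f T - f (S \<union> T) - f (S \<inter> T)\<bar> \<le> \<epsilon>)"

(* Since 0 is not in {1..n}, c 0 can serve as the constant term. *)
definition linear_set_fun :: "nat \<Rightarrow> (nat set \<Rightarrow> real) \<Rightarrow> bool" where
  "linear_set_fun n f \<longleftrightarrow>
     (\<exists>c :: nat \<Rightarrow> real. \<forall>S \<subseteq> {1..n}. f S = c 0 + (\<Sum>i\<in>S. c i))"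

definition approx_linear :: "nat \<Rightarrow> real \<Rightarrow> (nat set \<Rightarrow> real) \<Rightarrow> bool" where
  "approx_linear n \<Delta> f \<longleftrightarrow>
     (\<exists>l. linear_set_fun n l \<and> (\<forall>S \<subseteq> {1..n}. \<bar>f S - l S\<bar> \<le> \<Delta>))"

definition weak_Kalton_bound :: "real \<Rightarrow> bool" where
  "weak_Kalton_bound K \<longleftrightarrow>
     (\<forall>n \<epsilon> f. \<epsilon> \<ge> 0 \<longrightarrow> weakly_modular n \<epsilon> f \<longrightarrow> approx_linear n (K * \<epsilon>) f)"

(* LEAST is meaningful as soon as some K is a bound: see weak_Kalton_const_least below. *)
definition weak_Kalton_const :: real where
  "weak_Kalton_const = (LEAST K. weak_Kalton_bound K)"

lemma convergent_subseq_finite: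
  fixes x :: "nat \<Rightarrow> nat \<Rightarrow> real"
  assumes "finite A" and "\<And>i. i \<in> A \<Longrightarrow> bounded (range (\<lambda>k. x k i))"
  shows "\<exists>r :: nat \<Rightarrow> nat. strict_mono r \<and> (\<forall>i\<in>A. convergent (\<lambda>k. x (r k) i))"
  using assms
proof (induction A rule: finite_induct)
  case empty
  show ?case using strict_mono_id by auto
next
  case (insert a A)
  then obtain r :: "nat \<Rightarrow> nat"
    where r: "strict_mono r" "\<forall>i\<in>A. convergent (\<lambda>k. x (r k) i)"
    by auto
  have "bounded (range (\<lambda>k. x k a))" using insert.prems by simp
  then have "bounded (range (\<lambda>k. x (r k) a))"
    by (rule bounded_subset) auto
  then obtain l s where s: "strict_mono s" "((\<lambda>k. x (r k) a) \<circ> s) \<longlonglongrightarrow> l"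
    using bounded_imp_convergent_subsequence by blast
  have "convergent (\<lambda>k. x ((r \<circ> s) k) i)" if i: "i \<in> insert a A" for i
  proof (cases "i = a")
    case True
    then show ?thesis using s(2) by (auto simp: convergent_def o_def)
  next
    case False
    with i r(2) have "convergent (\<lambda>k. x (r k) i)" by simp
    from convergent_subseq_convergent[OF this s(1)] show ?thesis by (simp add: o_def)
  qed
  moreover have "strict_mono (r \<circ> s)" using r(1) s(1) by (rule strict_mono_o)
  ultimately show ?case by blast
qed

lemma approx_linear_closed:
  assumes "\<And>d. d > D \<Longrightarrow> approx_linear n d f"
  shows "approx_linear n D f"
proof -
  define d where "d k = D + inverse (real (Suc k))" for k
  have dlim: "d \<longlonglongrightarrow> D"
    unfolding d_def using tendsto_add[OF tendsto_const LIMSEQ_inverse_real_of_nat, of D] by simp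
  have "\<exists>c :: nat \<Rightarrow> real. \<forall>S \<subseteq> {1..n}. \<bar>f S - (c 0 + (\<Sum>i\<in>S. c i))\<bar> \<le> d k" for k
  proof -
    have "approx_linear n (d k) f" by (rule assms) (simp add: d_def)
    then show ?thesis unfolding approx_linear_def linear_set_fun_def by metis
  qed
  then obtain c :: "nat \<Rightarrow> nat \<Rightarrow> real"
    where c: "\<And>k S. S \<subseteq> {1..n} \<Longrightarrow> \<bar>f S - (c k 0 + (\<Sum>i\<in>S. c k i))\<bar> \<le> d k"
    by metis
  have dle: "d k \<le> D + 1" for k by (simp add: d_def field_simps)
  have bdd: "bounded (range (\<lambda>k. c k i))" if i: "i \<in> {0..n}" for i
  proof (rule boundedI[where B = "2 * (D + 1) + \<bar>f {}\<bar> + \<bar>f {i}\<bar>"])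
    fix y assume "y \<in> range (\<lambda>k. c k i)"
    then obtain k where k: "y = c k i" by auto
    have 0: "\<bar>f {} - c k 0\<bar> \<le> d k" using c[of "{}" k] by simp
    show "norm y \<le> 2 * (D + 1) + \<bar>f {}\<bar> + \<bar>f {i}\<bar>"
    proof (cases "i = 0")
      case True
      then show ?thesis using 0 dle[of k] k by simp
    next
      case False
      then have "\<bar>f {i} - (c k 0 + c k i)\<bar> \<le> d k" using c[of "{i}" k] i by simp
      then show ?thesis using 0 dle[of k] k by simp
    qed
  qed
  obtain r :: "nat \<Rightarrow> nat" where r: "strict_mono r"
    and conv: "\<forall>i\<in>{0..n}. convergent (\<lambda>k. c (r k) i)"
    using convergent_subseq_finite[of "{0..n}" c] bdd by auto
  define b where "b i = lim (\<lambda>k. c (r k) i)" for i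
  have b: "(\<lambda>k. c (r k) i) \<longlonglongrightarrow> b i" if "i \<in> {0..n}" for i
    using conv that by (simp add: b_def convergent_LIMSEQ_iff)
  have "\<bar>f S - (b 0 + (\<Sum>i\<in>S. b i))\<bar> \<le> D" if S: "S \<subseteq> {1..n}" for S
  proof (rule LIMSEQ_le)
    show "(\<lambda>k. \<bar>f S - (c (r k) 0 + (\<Sum>i\<in>S. c (r k) i))\<bar>)
            \<longlonglongrightarrow> \<bar>f S - (b 0 + (\<Sum>i\<in>S. b i))\<bar>"
      using S by (intro tendsto_intros b) auto
    show "(d \<circ> r) \<longlonglongrightarrow> D" using dlim r by (rule LIMSEQ_subseq_LIMSEQ)
    show "\<exists>N. \<forall>k\<ge>N. \<bar>f S - (c (r k) 0 + (\<Sum>i\<in>S. c (r k) i))\<bar> \<le> (d \<circ> r) k"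
      using c[OF S] by simp
  qed
  then show ?thesis unfolding approx_linear_def linear_set_fun_def
    by (intro exI[of _ "\<lambda>S. b 0 + (\<Sum>i\<in>S. b i)"]) auto
qed

lemma weak_Kalton_bound_nonneg:
  assumes "weak_Kalton_bound K"
  shows "K \<ge> 0"
proof -
  have "weakly_modular 0 1 (\<lambda>S. 0)" by (simp add: weakly_modular_def)
  then have "approx_linear 0 (K * 1) (\<lambda>S. 0)"
    using assms unfolding weak_Kalton_bound_def by (meson zero_le_one)
  then obtain l where "\<bar>0 - l {}\<bar> \<le> K" unfolding approx_linear_def by auto
  then show ?thesis by linarith
qed

lemma weak_Kalton_const_least:
  assumes "weak_Kalton_bound K"
  shows "weak_Kalton_bound weak_Kalton_const" and "weak_Kalton_const \<le> K"
proof -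
  let ?B = "Collect weak_Kalton_bound"
  have bb: "bdd_below ?B" using weak_Kalton_bound_nonneg by (intro bdd_belowI[of _ 0]) auto
  have ne: "?B \<noteq> {}" using assms by auto
  have inf: "weak_Kalton_bound (Inf ?B)"
  proof (rule weak_Kalton_bound_def[THEN iffD2], intro allI impI)
    fix n f and e :: real
    assume e: "e \<ge> 0" and f: "weakly_modular n e f"
    show "approx_linear n (Inf ?B * e) f"
    proof (cases "e = 0")
      case True
      then show ?thesis using assms e f unfolding weak_Kalton_bound_def by fastforce
    next
      case False
      with e have e: "e > 0" by simp
      show ?thesis
      proof (rule approx_linear_closed)
        fix d :: real assume "d > Inf ?B * e"
        then have "Inf ?B < d / e" using e by (simp add: pos_less_divide_eq)
        then obtain K' where K': "weak_Kalton_bound K'" "K' < d / e"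
          using cInf_lessD[OF ne] by auto
        then have "approx_linear n (K' * e) f"
          using e f unfolding weak_Kalton_bound_def by auto
        moreover have "K' * e \<le> d" using K'(2) e by (simp add: field_simps)
        ultimately show "approx_linear n d f" unfolding approx_linear_def by (meson order_trans)
      qed
    qed
  qed
  have "weak_Kalton_const = Inf ?B"
    unfolding weak_Kalton_const_def
    by (rule Least_equality[where P = weak_Kalton_bound]) (use inf bb in \<open>auto intro: cInf_lower\<close>)
  with inf show "weak_Kalton_bound weak_Kalton_const" by simp
  show "weak_Kalton_const \<le> K"
    unfolding \<open>weak_Kalton_const = Inf ?B\<close> using assms bb by (auto intro: cInf_lower)
qed

end

theory Submission
  imports Defs
begin

text \<open>
  Let \<open>f\<close> be weakly \<open>\<epsilon>\<close>-modular with \<open>\<bar>f\<bar> \<le> M\<close>. If no linear function is within \<open>D\<close> of \<open>f\<close>, LP duality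
  yields two distributions on sets with the same item marginals whose expected values of \<open>f\<close> differ
  by at least \<open>2 D\<close>. For independent \<open>S\<close>, \<open>T\<close> drawn from them, weak modularity gives
  \<open>f (S - T) - f (T - S) \<ge> f S - f T - 2 \<epsilon>\<close>, and now every item lies in \<open>S - T\<close> with probability
  \<open>p (1 - p) \<le> 1/4\<close>, and likewise for \<open>T - S\<close>.

  A bipartite graph with \<open>4 q\<close> left vertices of degree 6 and \<open>2 q\<close> right vertices in which every set of
  at most \<open>q\<close> left vertices can be matched exists by a union bound. Following Kalton and Roberts, it
  allows \<open>4 q\<close> sets covering each item at most \<open>q\<close> times to be cut into pieces and reassembled into
  \<open>2 q\<close> sets, at a cost of at most \<open>11 \<epsilon>\<close> per original set. Since the new sets have values at most
  \<open>M\<close>, this gives \<open>D \<le> M / 2 + 12 \<epsilon>\<close>. Hence the distance \<open>M\<close> to the linear functions can always be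
  improved to \<open>M / 2 + 12 \<epsilon>\<close>, and iterating brings it down to \<open>24 \<epsilon>\<close>.
\<close>

subsection \<open>Hall's theorem and expanders\<close>

text \<open>Halmos-Vaughan induction on \<open>card I\<close>. If some nonempty proper
  \<open>X\<close> is tight, \<open>X\<close> is matched into its neighbourhood and the rest outside
  it. Otherwise every nonempty proper subset has a spare neighbour, so one index may be matched
  arbitrarily.\<close>

lemma hall_marriage:
  fixes N :: "'a \<Rightarrow> 'b set"
  assumes "finite I" and "\<And>i. i \<in> I \<Longrightarrow> finite (N i)"
    and "\<And>X. X \<subseteq> I \<Longrightarrow> card X \<le> card (\<Union>(N ` X))"
  shows "\<exists>h. inj_on h I \<and> (\<forall>i\<in>I. h i \<in> N i)"
  using assms
proof (induction "card I" arbitrary: I N rule: less_induct)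
  case less
  note fin = \<open>finite I\<close> and finN = less.prems(2) and hall = less.prems(3)
  show ?case
  proof (cases "I = {}")
    case True
    then show ?thesis by simp
  next
    case ne: False
    show ?thesis
    proof (cases "\<exists>X. X \<subset> I \<and> X \<noteq> {} \<and> card X = card (\<Union>(N ` X))")
      case True
      then obtain X where X: "X \<subset> I" "X \<noteq> {}" "card X = card (\<Union>(N ` X))" by blast
      have finX: "finite X" using X fin finite_subset by blast
      have "\<exists>g. inj_on g X \<and> (\<forall>i\<in>X. g i \<in> N i)"
      proof (rule less.hyps)
        show "card X < card I" using X(1) fin by (rule psubset_card_mono[rotated])
        show "card Z \<le> card (\<Union>(N ` Z))" if "Z \<subseteq> X" for Z using hall[of Z] that X by blast
      qed (use finX X finN in auto)
      then obtain g where g: "inj_on g X" "\<And>i. i \<in> X \<Longrightarrow> g i \<in> N i" by blast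
      define U where "U = \<Union>(N ` X)"
      have finU: "finite U" unfolding U_def using finX X finN by blast
      have "\<exists>h. inj_on h (I - X) \<and> (\<forall>i\<in>I - X. h i \<in> N i - U)"
      proof (rule less.hyps)
        show "card (I - X) < card I" using X fin by (intro psubset_card_mono) auto
        show "card Z \<le> card (\<Union>i\<in>Z. N i - U)" if Z: "Z \<subseteq> I - X" for Z
        proof -
          have finZ: "finite Z" using Z fin finite_subset by blast
          \<comment> \<open>Hall's condition for \<open>Z\<close> after deleting \<open>U\<close>:
            apply the original condition to \<open>Z \<union> X\<close> and subtract the tight
            equality for \<open>X\<close>.\<close>
          have "card Z + card X = card (Z \<union> X)"
            using Z finZ finX by (subst card_Un_disjoint) auto
          also have "\<dots> \<le> card (\<Union>(N ` (Z \<union> X)))" using Z X by (intro hall) auto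
          also have "\<Union>(N ` (Z \<union> X)) = (\<Union>i\<in>Z. N i - U) \<union> U" unfolding U_def by auto
          also have "card \<dots> \<le> card (\<Union>i\<in>Z. N i - U) + card U" by (rule card_Un_le)
          finally show ?thesis using X(3) U_def by simp
        qed
      qed (use fin finN in auto)
      then obtain h where h: "inj_on h (I - X)" "\<And>i. i \<in> I - X \<Longrightarrow> h i \<in> N i - U" by blast
      have gU: "g i \<in> U" if "i \<in> X" for i using g(2) that U_def by blast
      let ?f = "\<lambda>i. if i \<in> X then g i else h i"
      have "inj_on ?f I"
        by (rule inj_onI) (use g h gU in \<open>fastforce simp: inj_on_def split: if_splits\<close>)
      moreover have "\<forall>i\<in>I. ?f i \<in> N i" using g h by auto
      ultimately show ?thesis by blast
    next
      case False
      obtain a where a: "a \<in> I" using ne by blast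
      have "card {a} \<le> card (N a)" using hall[of "{a}"] a by simp
      then obtain b where b: "b \<in> N a" by fastforce
      have "\<exists>h. inj_on h (I - {a}) \<and> (\<forall>i\<in>I - {a}. h i \<in> N i - {b})"
      proof (rule less.hyps)
        show "card (I - {a}) < card I" using a fin by (intro psubset_card_mono) auto
        show "card Z \<le> card (\<Union>i\<in>Z. N i - {b})" if Z: "Z \<subseteq> I - {a}" for Z
        proof (cases "Z = {}")
          case False
          have "Z \<subset> I" using Z a by blast
          \<comment> \<open>Strictness for the non-tight \<open>Z\<close> pays for the loss of the
            single vertex \<open>b\<close>.\<close>
          then have "card Z < card (\<Union>(N ` Z))"
            using hall[of Z] False \<open>\<nexists>X. _ X\<close> by (meson le_neq_implies_less psubset_imp_subset)
          moreover have "finite (\<Union>(N ` Z))"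
            using Z fin finN by (intro finite_UN_I) (auto intro: finite_subset)
          moreover have "(\<Union>i\<in>Z. N i - {b}) = \<Union>(N ` Z) - {b}" by auto
          ultimately show ?thesis by (simp add: card_Diff_singleton_if) arith
        qed simp
      qed (use fin finN in auto)
      then obtain h where h: "inj_on h (I - {a})" "\<And>i. i \<in> I - {a} \<Longrightarrow> h i \<in> N i - {b}" by blast
      have "inj_on (h(a := b)) I"
        by (rule inj_onI) (use h in \<open>fastforce simp: inj_on_def split: if_splits\<close>)
      moreover have "\<forall>i\<in>I. (h(a := b)) i \<in> N i" using h b by auto
      ultimately show ?thesis by blast
    qed
  qed
qed

text \<open>Union bound in counting form. A graph is a function \<open>\<phi>\<close> giving the end
  of the \<open>a\<close>-th edge at \<open>j\<close>; repeated edges are allowed. A violating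
  \<open>X\<close> of size \<open>s\<close> sends its \<open>r * s\<close> edges into some
  \<open>Y\<close> of size \<open>s\<close>, which happens for a fraction
  \<open>(s / m) ^ (r * s)\<close> of all \<open>\<phi>\<close>. Hence \<open>small\<close> leaves a
  \<open>\<phi>\<close> outside \<open>Bad\<close>.\<close>

lemma expander_exists:
  fixes k m r d :: nat
  assumes m: "m > 0"
    and small: "(\<Sum>s=1..d. real (k choose s) * real (m choose s) * (real s / real m) ^ (r * s)) < 1"
    and dm: "d \<le> m"
  shows "\<exists>\<phi>. (\<forall>j<k. \<forall>a<r. \<phi> (j, a) < m) \<and>
    (\<forall>X\<subseteq>{..<k}. card X \<le> d \<longrightarrow> card X \<le> card (\<phi> ` (X \<times> {..<r})))"
proof -
  define F where "F = ({..<k} \<times> {..<r}) \<rightarrow>\<^sub>E {..<m}"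
  define B where "B X Y = {\<phi>\<in>F. \<phi> ` (X \<times> {..<r}) \<subseteq> Y}" for X :: "nat set" and Y :: "nat set"
  define sub where "sub n s = {X. X \<subseteq> {..<n} \<and> card X = s}" for n s :: nat
  define Bad where "Bad = (\<Union>s\<in>{1..d}. \<Union>X\<in>sub k s. \<Union>Y\<in>sub m s. B X Y)"
  have finF: "finite F" unfolding F_def by (intro finite_PiE) auto
  have cardF: "card F = m ^ (k * r)" unfolding F_def by (simp add: card_funcsetE)
  have fsub: "finite (sub n s)" for n s unfolding sub_def by simp
  have csub: "card (sub n s) = n choose s" for n s
    unfolding sub_def using n_subsets[of "{..<n}" s] by simp
  have cardB: "real (card (B X Y)) = (real s / real m) ^ (r * s) * real m ^ (k * r)"
    if "X \<in> sub k s" "Y \<in> sub m s" for X Y s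
  proof -
    have X: "X \<subseteq> {..<k}" "card X = s" and Y: "Y \<subseteq> {..<m}" "card Y = s"
      using that by (auto simp: sub_def)
    have sk: "s \<le> k" using card_mono[OF _ X(1)] X(2) by simp
    have "B X Y = (\<Pi>\<^sub>E p\<in>{..<k} \<times> {..<r}. if p \<in> X \<times> {..<r} then Y else {..<m})"
      unfolding B_def F_def using X Y
      by (auto simp: PiE_iff extensional_def image_subset_iff split: if_splits) blast+
    then have "card (B X Y) = (\<Prod>p\<in>{..<k} \<times> {..<r}. if p \<in> X \<times> {..<r} then s else m)"
      using Y by (simp add: card_PiE if_distrib cong: if_cong)
    also have "\<dots> = (\<Prod>p\<in>X \<times> {..<r}. s) * (\<Prod>p\<in>({..<k} - X) \<times> {..<r}. m)"
    proof -
      have "({..<k} \<times> {..<r}) \<inter> X \<times> {..<r} = X \<times> {..<r}"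
        "({..<k} \<times> {..<r}) \<inter> - (X \<times> {..<r}) = ({..<k} - X) \<times> {..<r}" using X by auto
      then show ?thesis by (subst prod.If_cases) simp_all
    qed
    also have "\<dots> = s ^ (r * s) * m ^ (r * (k - s))"
      using X finite_subset[OF X(1)] by (simp add: card_Diff_subset card_cartesian_product mult.commute)
    finally have "real (card (B X Y)) = real s ^ (r * s) * real m ^ (r * (k - s))" by simp
    also have "real m ^ (r * (k - s)) = real m ^ (k * r) / real m ^ (r * s)"
      using m sk by (simp add: power_diff diff_mult_distrib2 mult.commute)
    finally show ?thesis by (simp add: power_divide)
  qed
  have "real (card Bad) \<le> (\<Sum>s=1..d. \<Sum>X\<in>sub k s. \<Sum>Y\<in>sub m s. real (card (B X Y)))"
  proof -
    have "card Bad \<le> (\<Sum>s=1..d. \<Sum>X\<in>sub k s. \<Sum>Y\<in>sub m s. card (B X Y))"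
      unfolding Bad_def by (intro order_trans[OF card_UN_le] sum_mono finite_atLeastAtMost fsub order_refl)
    then have "real (card Bad) \<le> real (\<Sum>s=1..d. \<Sum>X\<in>sub k s. \<Sum>Y\<in>sub m s. card (B X Y))"
      by (rule of_nat_mono)
    then show ?thesis by simp
  qed
  also have "\<dots> = (\<Sum>s=1..d. real (k choose s) * real (m choose s) * (real s / real m) ^ (r * s)) * real m ^ (k * r)"
    by (simp add: cardB csub sum_distrib_right mult.assoc)
  also have "\<dots> < real m ^ (k * r)" using small m by simp
  also have "\<dots> = real (card F)" by (simp add: cardF)
  finally have "card Bad < card F" by simp
  moreover have "finite Bad" unfolding Bad_def B_def using finF fsub by auto
  ultimately obtain \<phi> where \<phi>: "\<phi> \<in> F" "\<phi> \<notin> Bad"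
    by (meson card_mono leD subsetI)
  have "card X \<le> card (\<phi> ` (X \<times> {..<r}))" if X: "X \<subseteq> {..<k}" "card X \<le> d" for X
  proof (rule ccontr)
    assume less: "\<not> ?thesis"
    let ?N = "\<phi> ` (X \<times> {..<r})"
    have N: "?N \<subseteq> {..<m}" using \<phi>(1) X unfolding F_def by (auto simp: PiE_iff)
    \<comment> \<open>The too small neighbourhood is padded to exactly \<open>card X\<close>
      vertices, so that only pairs of equal size had to be counted; \<open>dm\<close> provides the
      room.\<close>
    obtain Y where Y: "?N \<subseteq> Y" "Y \<subseteq> {..<m}" "card Y = card X"
      using exists_subset_between[of ?N "card X" "{..<m}"] N less X(2) dm by auto
    have "\<phi> \<in> B X Y" using \<phi> Y unfolding B_def by auto
    moreover have "X \<in> sub k (card X)" "Y \<in> sub m (card X)" using X Y by (auto simp: sub_def)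
    moreover have "card X \<in> {1..d}" using less X by auto
    ultimately show False using \<phi>(2) unfolding Bad_def by blast
  qed
  moreover have "\<phi> (j, a) < m" if "j < k" "a < r" for j a
    using \<phi>(1) that unfolding F_def by (auto simp: PiE_iff)
  ultimately show ?thesis by blast
qed

text \<open>\<open>s ^ s / fact s\<close> is a single term of the exponential series at
  \<open>s\<close>.\<close>

lemma power_self_le_exp_fact: "real s ^ s \<le> exp (real s) * fact s"
proof -
  have "(\<Sum>n\<in>{s}. real s ^ n /\<^sub>R fact n) \<le> (\<Sum>n. real s ^ n /\<^sub>R fact n)"
    by (intro sum_le_suminf summable_exp_generic) auto
  then show ?thesis by (simp add: exp_def field_simps)
qed

text \<open>By \<open>(n choose s) * s ^ s \<le> (e * n) ^ s\<close>, the \<open>s\<close>-th term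
  of the union bound is at most \<open>(z * (s / q) ^ 4) ^ s\<close>. For degree \<open>r\<close>
  the constant would be \<open>8 * e^2 / 2 ^ r\<close>; 6 is the first degree that makes it smaller
  than 1.\<close>

lemma eventually_expander_6:
  "eventually (\<lambda>q. \<exists>\<phi>. (\<forall>j<4*q. \<forall>a<6. \<phi> (j, a) < 2*q) \<and>
     (\<forall>X\<subseteq>{..<4*q}. card X \<le> q \<longrightarrow> card X \<le> card (\<phi> ` (X \<times> {..<6::nat})))) sequentially"
proof -
  define z :: real where "z = (exp 1)\<^sup>2 / 8"
  have "(exp 1 :: real) ^ 2 < (272/100) ^ 2"
    by (rule power_strict_mono[OF e_less_272]) auto
  then have z: "0 < z" "z < 1" unfolding z_def by (auto simp: power2_eq_square)
  have sms: "summable (\<lambda>s. real (Suc s) * z ^ s)"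
    using sums_summable[OF geometric_deriv_sums[of z]] z by simp
  define C where "C = (\<Sum>s. real (Suc s) * z ^ s)"
  have C: "(\<Sum>s=1..q. real s * z ^ s) \<le> C" for q
  proof -
    have "(\<Sum>s=1..q. real s * z ^ s) \<le> (\<Sum>s=1..q. real (Suc s) * z ^ s)"
      using z by (intro sum_mono mult_right_mono) auto
    also have "\<dots> \<le> C" unfolding C_def using z by (intro sum_le_suminf sms) auto
    finally show ?thesis .
  qed
  have term_le: "real (4*q choose s) * real (2*q choose s) * (real s / real (2*q)) ^ (6 * s)
      \<le> real s * z ^ s / real q" if s: "s \<in> {1..q}" for s q
  proof -
    have q: "real q > 0" using s by auto
    have ch: "real (n choose s) * real s ^ s \<le> (exp 1 * real n) ^ s" for n
    proof -
      have "real (n choose s) * real s ^ s \<le> real (n choose s) * (exp (real s) * fact s)"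
        by (intro mult_left_mono power_self_le_exp_fact) auto
      also have "\<dots> = exp (real s) * real ((n choose s) * fact s)" by simp
      also have "\<dots> \<le> exp (real s) * real (n ^ s)"
        by (intro mult_left_mono of_nat_mono binomial_fact_pow) auto
      finally show ?thesis
        by (simp add: power_mult_distrib exp_of_nat_mult[of s 1, simplified])
    qed
    have "real (4*q choose s) * real (2*q choose s) * (real s / real (2*q)) ^ (6 * s)
       = (real (4*q choose s) * real s ^ s) * (real (2*q choose s) * real s ^ s)
          * (real s ^ (4* s) / real (2*q) ^ (6* s))"
      by (simp add: power_divide power_add[symmetric])
    also have "\<dots> \<le> ((exp 1 * real (4*q)) ^ s * (exp 1 * real (2*q)) ^ s)
          * (real s ^ (4* s) / real (2*q) ^ (6* s))"
      by (intro mult_right_mono mult_mono ch) auto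
    also have "\<dots> = (((exp 1 * real (4*q)) * (exp 1 * real (2*q))) * (real s ^ 4 / real (2*q) ^ 6)) ^ s"
      by (simp only: power_mult_distrib power_divide power_mult)
    also have "((exp 1 * real (4*q)) * (exp 1 * real (2*q))) * (real s ^ 4 / real (2*q) ^ 6)
        = z * (real s / real q) ^ 4"
      using q unfolding z_def by (simp add: field_simps power2_eq_square eval_nat_numeral)
    also have "(z * (real s / real q) ^ 4) ^ s = z ^ s * (real s / real q) ^ (4 * s)"
      by (simp only: power_mult_distrib power_mult)
    \<comment> \<open>Since \<open>s / q \<le> 1\<close>, all but one of its powers may be dropped.
      The one that is kept makes the whole sum at most \<open>C / q\<close>.\<close>
    also have "\<dots> \<le> z ^ s * (real s / real q) ^ 1"
      using s q z by (intro mult_left_mono power_decreasing) auto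
    finally show ?thesis by (simp add: mult.commute)
  qed
  have "eventually (\<lambda>q. real q > C) sequentially"
    by (rule filterlim_real_sequentially[unfolded filterlim_at_top_dense, rule_format])
  then show ?thesis
    using eventually_gt_at_top[of 0]
  proof eventually_elim
    case (elim q)
    have "(\<Sum>s=1..q. real (4*q choose s) * real (2*q choose s) * (real s / real (2*q)) ^ (6 * s))
        \<le> (\<Sum>s=1..q. real s * z ^ s / real q)" by (intro sum_mono term_le)
    also have "\<dots> = (\<Sum>s=1..q. real s * z ^ s) / real q" by (simp add: sum_divide_distrib)
    also have "\<dots> \<le> C / real q" using C elim by (intro divide_right_mono) auto
    also have "\<dots> < 1" using elim by simp
    finally show ?case using elim by (intro expander_exists) auto
  qed
qed

subsection \<open>Gordan's alternative\<close>

text \<open>The cone spanned by a set of vectors, kept inductive so that Fourier--Motzkin elimination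
  does not have to track coefficients.\<close>

inductive_set pos_cone :: "('i \<Rightarrow> real) set \<Rightarrow> ('i \<Rightarrow> real) set" for V where
  base: "v \<in> V \<Longrightarrow> v \<in> pos_cone V"
| comb: "u \<in> pos_cone V \<Longrightarrow> v \<in> pos_cone V \<Longrightarrow> a > 0 \<Longrightarrow> b > 0 \<Longrightarrow>
    (\<lambda>i. a * u i + b * v i) \<in> pos_cone V"

text \<open>Recovers explicit coefficients from the inductive cone. Their sum is positive because
  both scalars in \<open>comb\<close> are strictly positive, so the trivial combination never
  arises.\<close>

lemma pos_cone_weights:
  fixes g :: "'p \<Rightarrow> 'i \<Rightarrow> real"
  assumes "finite P" and "z \<in> pos_cone (g ` P)"
  shows "\<exists>w. (\<forall>p\<in>P. w p \<ge> 0) \<and> (\<Sum>p\<in>P. w p) > 0 \<and> (\<forall>i. z i = (\<Sum>p\<in>P. w p * g p i))"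
  using assms(2)
proof induction
  case (base v)
  then obtain p where p: "p \<in> P" "v = g p" by blast
  have "(\<Sum>u\<in>P. (if u = p then 1 else 0) * h u) = h p" for h :: "'p \<Rightarrow> real"
    using assms(1) p by (simp add: if_distrib[of "\<lambda>c. c * _"] cong: if_cong)
  from this[of "\<lambda>_. 1"] this p show ?case
    by (intro exI[of _ "\<lambda>u. if u = p then 1 else 0"]) simp
next
  case (comb u v a b)
  then obtain w w' where w: "\<forall>p\<in>P. w p \<ge> 0" "(\<Sum>p\<in>P. w p) > 0" "\<forall>i. u i = (\<Sum>p\<in>P. w p * g p i)"
    and w': "\<forall>p\<in>P. w' p \<ge> 0" "(\<Sum>p\<in>P. w' p) > 0" "\<forall>i. v i = (\<Sum>p\<in>P. w' p * g p i)" by blast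
  show ?case
  proof (intro exI[of _ "\<lambda>p. a * w p + b * w' p"] conjI)
    show "\<forall>p\<in>P. a * w p + b * w' p \<ge> 0" using w w' comb by simp
    show "(\<Sum>p\<in>P. a * w p + b * w' p) > 0"
      using w w' comb by (simp add: sum.distrib sum_distrib_left[symmetric] add_pos_pos)
    show "\<forall>i. a * u i + b * v i = (\<Sum>p\<in>P. (a * w p + b * w' p) * g p i)"
      using w(3) w'(3) by (simp add: sum.distrib sum_distrib_left algebra_simps)
  qed
qed

text \<open>Picks the value of an eliminated variable between its lower and upper bounds; either set
  of bounds may be empty.\<close>

lemma finite_sets_separated:
  fixes X Y :: "real set"
  assumes "finite X" "finite Y" and "\<And>x y. x \<in> X \<Longrightarrow> y \<in> Y \<Longrightarrow> x < y"
  shows "\<exists>t. (\<forall>x\<in>X. x < t) \<and> (\<forall>y\<in>Y. t < y)"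
proof (cases "X = {} \<or> Y = {}")
  case True
  then show ?thesis
  proof
    assume "X = {}"
    then show ?thesis using Min_le[OF assms(2)]
      by (intro exI[of _ "Min Y - 1"]) force
  next
    assume "Y = {}"
    then show ?thesis using Max_ge[OF assms(1)]
      by (intro exI[of _ "Max X + 1"]) force
  qed
next
  case False
  then have "Max X < Min Y" using assms by simp
  then obtain t where "Max X < t" "t < Min Y" using dense by blast
  then show ?thesis using assms False
    by (intro exI[of _ t]) auto
qed

text \<open>Fourier-Motzkin elimination of the coordinate \<open>a\<close>: \<open>V'\<close> keeps
  the vectors vanishing at \<open>a\<close> and adds, for each pair of opposite signs at
  \<open>a\<close>, the positive combination that cancels there. A solution for \<open>V'\<close>
  extends to \<open>a\<close>; a cone vector of \<open>V'\<close> is a cone vector of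
  \<open>V\<close> that vanishes at \<open>a\<close>.\<close>

lemma gordan_alternative:
  fixes V :: "('i \<Rightarrow> real) set"
  assumes "finite A" "finite V"
  shows "(\<exists>x. \<forall>v\<in>V. (\<Sum>i\<in>A. v i * x i) > 0) \<or> (\<exists>z\<in>pos_cone V. \<forall>i\<in>A. z i = 0)"
  using assms
proof (induction A arbitrary: V rule: finite_induct)
  case empty
  then show ?case by (cases "V = {}") (auto intro: pos_cone.base)
next
  case (insert a A)
  define P where "P = {v\<in>V. v a > 0}"
  define N where "N = {v\<in>V. v a < 0}"
  define elim where "elim = (\<lambda>(u :: 'i \<Rightarrow> real, v) i. (- v a) * u i + u a * v i)"
  define V' where "V' = {v\<in>V. v a = 0} \<union> elim ` (P \<times> N)"
  have "finite V'" unfolding V'_def P_def N_def using insert.prems by simp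
  from insert.IH[OF this] show ?case
  proof
    assume "\<exists>z\<in>pos_cone V'. \<forall>i\<in>A. z i = 0"
    then obtain z where z: "z \<in> pos_cone V'" "\<forall>i\<in>A. z i = 0" by blast
    have "z \<in> pos_cone V \<and> z a = 0" using z(1)
    proof induction
      case (base v)
      show ?case
      proof (cases "v \<in> V \<and> v a = 0")
        case False
        then obtain u w where uw: "u \<in> V" "u a > 0" "w \<in> V" "w a < 0" "v = elim (u, w)"
          using base unfolding V'_def P_def N_def by auto
        then have "elim (u, w) \<in> pos_cone V"
          unfolding elim_def prod.case by (intro pos_cone.intros) auto
        then show ?thesis using uw by (simp add: elim_def)
      qed (auto intro: pos_cone.base)
    qed (auto intro: pos_cone.comb)
    then show ?thesis using z by auto
  next
    assume "\<exists>x. \<forall>v\<in>V'. (\<Sum>i\<in>A. v i * x i) > 0"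
    then obtain x where x: "\<And>v. v \<in> V' \<Longrightarrow> (\<Sum>i\<in>A. v i * x i) > 0" by blast
    define L where "L v = (\<Sum>i\<in>A. v i * x i)" for v
    \<comment> \<open>The condition \<open>v a * t + L v > 0\<close> bounds \<open>t\<close> from
      below by \<open>- L v / v a\<close> for \<open>v\<close> in \<open>P\<close> and from above
      for \<open>v\<close> in \<open>N\<close>. The bounds are compatible because \<open>x\<close>
      is positive on each \<open>elim (u, v)\<close>.\<close>
    have "\<exists>t. (\<forall>y\<in>(\<lambda>u. - L u / u a) ` P. y < t) \<and> (\<forall>y\<in>(\<lambda>u. - L u / u a) ` N. t < y)"
    proof (rule finite_sets_separated)
      show "finite ((\<lambda>u. - L u / u a) ` P)" "finite ((\<lambda>u. - L u / u a) ` N)"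
        unfolding P_def N_def using insert.prems by auto
      fix y y' assume "y \<in> (\<lambda>u. - L u / u a) ` P" "y' \<in> (\<lambda>u. - L u / u a) ` N"
      then obtain u v where u: "u \<in> P" "y = - L u / u a" and v: "v \<in> N" "y' = - L v / v a" by blast
      have "0 < L (elim (u, v))" unfolding L_def using u v by (intro x) (auto simp: V'_def)
      also have "L (elim (u, v)) = (- v a) * L u + u a * L v"
        unfolding L_def elim_def by (simp add: sum_distrib_left flip: sum.distrib) (simp add: algebra_simps)
      finally have "v a * L u < u a * L v" by simp
      moreover have "u a > 0" "v a < 0" using u v by (auto simp: P_def N_def)
      ultimately show "y < y'" unfolding u(2) v(2) by (simp add: field_simps)
    qed
    then obtain t where t: "\<And>u. u \<in> P \<Longrightarrow> - L u / u a < t" "\<And>u. u \<in> N \<Longrightarrow> t < - L u / u a" by blast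
    have "(\<Sum>i\<in>insert a A. v i * (x(a := t)) i) > 0" if v: "v \<in> V" for v
    proof -
      have "(\<Sum>i\<in>insert a A. v i * (x(a := t)) i) = v a * t + L v"
        unfolding L_def using insert.hyps by (auto intro!: sum.cong)
      moreover have "v a * t + L v > 0"
      proof (cases "v a" "0 :: real" rule: linorder_cases)
        case less
        then show ?thesis using t(2)[of v] v unfolding N_def by (simp add: field_simps)
      next
        case equal
        then show ?thesis using x[of v] v unfolding V'_def L_def by simp
      next
        case greater
        then show ?thesis using t(1)[of v] v unfolding P_def by (simp add: field_simps)
      qed
      ultimately show ?thesis by simp
    qed
    then show ?thesis by blast
  qed
qed

subsection \<open>Weakly modular functions\<close>

lemma weakly_modular_disjoint:
  assumes "weakly_modular n \<epsilon> f" "S \<subseteq> {1..n}" "T \<subseteq> {1..n}" "S \<inter> T = {}"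
  shows "\<bar>f S + f T - f (S \<union> T) - f {}\<bar> \<le> \<epsilon>"
  using assms unfolding weakly_modular_def by metis

lemma weakly_modular_nonneg: "weakly_modular n \<epsilon> f \<Longrightarrow> \<epsilon> \<ge> 0"
  using weakly_modular_disjoint[of n \<epsilon> f "{}" "{}"] by simp

lemma weakly_modular_uminus: "weakly_modular n \<epsilon> f \<Longrightarrow> weakly_modular n \<epsilon> (\<lambda>S. - f S)"
  unfolding weakly_modular_def by (smt (verit))

text \<open>Truncated subtraction makes the bound correct for the empty family as well.\<close>

lemma weakly_modular_disjoint_union:
  assumes wm: "weakly_modular n \<epsilon> f" and "finite E"
    and "\<And>e. e \<in> E \<Longrightarrow> P e \<subseteq> {1..n}" and "disjoint_family_on P E"
  shows "\<bar>(\<Sum>e\<in>E. f (P e) - f {}) - (f (\<Union>(P ` E)) - f {})\<bar> \<le> real (card E - 1) * \<epsilon>"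
  using assms(2-)
proof (induction E rule: finite_induct)
  case (insert e E)
  have IH: "\<bar>(\<Sum>e\<in>E. f (P e) - f {}) - (f (\<Union>(P ` E)) - f {})\<bar> \<le> real (card E - 1) * \<epsilon>"
    using insert by (auto simp: disjoint_family_on_def)
  show ?case
  proof (cases "E = {}")
    case False
    then have "card E > 0" using insert.hyps by (simp add: card_gt_0_iff)
    then have card: "real (card (insert e E) - 1) = real (card E - 1) + 1"
      using insert.hyps by simp
    have "\<bar>f (P e) + f (\<Union>(P ` E)) - f (P e \<union> \<Union>(P ` E)) - f {}\<bar> \<le> \<epsilon>"
      using insert by (intro weakly_modular_disjoint[OF wm]) (auto simp: disjoint_family_on_def)
    then show ?thesis using IH insert.hyps unfolding card by (simp add: algebra_simps)
  qed simp
qed simp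

section \<open>Cutting and reassembling sets along an expander\<close>

text \<open>Each item is routed by a Hall matching from the sets containing it to distinct right
  vertices. This cuts every set into pieces, and the pieces arriving at one right vertex are disjoint.\<close>

lemma expander_bound:
  assumes wm: "weakly_modular n \<epsilon> f"
    and M: "\<And>S. S \<subseteq> {1..n} \<Longrightarrow> f S \<le> M"
    and \<phi>: "\<And>j a. j < k \<Longrightarrow> a < r \<Longrightarrow> \<phi> (j, a) < m"
    and expand: "\<And>X. X \<subseteq> {..<k} \<Longrightarrow> card X \<le> d \<Longrightarrow> card X \<le> card (\<phi> ` (X \<times> {..<r}))"
    and A: "\<And>j. j < k \<Longrightarrow> A j \<subseteq> {1..n}"
    and few: "\<And>i. i \<in> {1..n} \<Longrightarrow> card {j\<in>{..<k}. i \<in> A j} \<le> d"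
  shows "(\<Sum>j<k. f (A j) - f {}) \<le> real m * (M - f {}) + (real k * real (r - 1) + real k * real r) * \<epsilon>"
proof -
  define I where "I i = {j\<in>{..<k}. i \<in> A j}" for i
  \<comment> \<open>Hall's theorem applies to the at most \<open>d\<close> sets containing
    \<open>i\<close>. It chooses right vertices; \<open>e\<close> records an edge index leading to
    each, because parallel edges may share an endpoint.\<close>
  have "\<exists>e. (\<forall>j\<in>I i. e j < r) \<and> inj_on (\<lambda>j. \<phi> (j, e j)) (I i)" if i: "i \<in> {1..n}" for i
  proof -
    have "\<exists>h. inj_on h (I i) \<and> (\<forall>j\<in>I i. h j \<in> \<phi> ` ({j} \<times> {..<r}))"
    proof (rule hall_marriage)
      show "card X \<le> card (\<Union>j\<in>X. \<phi> ` ({j} \<times> {..<r}))" if X: "X \<subseteq> I i" for X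
      proof -
        have "card X \<le> card (I i)" using X by (intro card_mono) (auto simp: I_def)
        then have "card X \<le> card (\<phi> ` (X \<times> {..<r}))"
          using X few[OF i] by (intro expand) (auto simp: I_def)
        moreover have "\<phi> ` (X \<times> {..<r}) = (\<Union>j\<in>X. \<phi> ` ({j} \<times> {..<r}))" by auto
        ultimately show ?thesis by simp
      qed
    qed (auto simp: I_def)
    then obtain h where h: "inj_on h (I i)" "\<forall>j\<in>I i. \<exists>a<r. h j = \<phi> (j, a)" by blast
    then obtain e where e: "\<forall>j\<in>I i. e j < r \<and> h j = \<phi> (j, e j)" by metis
    then have "inj_on (\<lambda>j. \<phi> (j, e j)) (I i)"
      using h(1) by (simp add: inj_on_def)
    with e show ?thesis by blast
  qed
  then obtain e where e: "\<And>i j. i \<in> {1..n} \<Longrightarrow> j \<in> I i \<Longrightarrow> e i j < r"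
      "\<And>i. i \<in> {1..n} \<Longrightarrow> inj_on (\<lambda>j. \<phi> (j, e i j)) (I i)" by metis
  define piece where "piece = (\<lambda>(j, a). {i\<in>A j. e i j = a})"
  define g where "g S = f S - f {}" for S
  define E where "E = {..<k} \<times> {..<r}"
  define Ev where "Ev v = {p\<in>E. \<phi> p = v}" for v
  have finE: "finite E" "\<And>v. finite (Ev v)" unfolding E_def Ev_def by auto
  have pc: "piece p \<subseteq> {1..n}" if "p \<in> E" for p
    using that A unfolding piece_def E_def by fastforce
  have split: "g (A j) \<le> (\<Sum>a<r. g (piece (j, a))) + real (r - 1) * \<epsilon>" if j: "j < k" for j
  proof -
    have "(\<Union>a<r. piece (j, a)) = A j"
      using e(1) A[OF j] j unfolding piece_def I_def by auto
    moreover have "disjoint_family_on (\<lambda>a. piece (j, a)) {..<r}"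
      unfolding disjoint_family_on_def piece_def by auto
    ultimately show ?thesis
      using weakly_modular_disjoint_union[OF wm, of "{..<r}" "\<lambda>a. piece (j, a)"] pc j
      unfolding g_def E_def by (auto simp: abs_le_iff)
  qed
  have merge: "(\<Sum>p\<in>Ev v. g (piece p)) \<le> (M - f {}) + real (card (Ev v)) * \<epsilon>" for v
  proof -
    \<comment> \<open>An item on two edges into \<open>v\<close> would come either from two sets,
      against injectivity of the matching, or from one set along two edges, although
      \<open>e i j\<close> is a single index.\<close>
    have "disjoint_family_on piece (Ev v)"
      unfolding disjoint_family_on_def
    proof (intro ballI impI, rule ccontr)
      fix p p' assume p: "p \<in> Ev v" "p' \<in> Ev v" "p \<noteq> p'" and ne: "piece p \<inter> piece p' \<noteq> {}"
      obtain j a j' a' where eq: "p = (j, a)" "p' = (j', a')" by fastforce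
      from ne obtain i where i: "i \<in> A j" "e i j = a" "i \<in> A j'" "e i j' = a'"
        unfolding piece_def eq by auto
      have j: "j < k" "j' < k" "\<phi> (j, a) = \<phi> (j', a')" using p unfolding Ev_def E_def eq by auto
      have i': "i \<in> {1..n}" using i A j by blast
      have "j \<in> I i" "j' \<in> I i" using i j by (auto simp: I_def)
      then have "j = j'" using inj_onD[OF e(2)[OF i'], of j j'] i j by simp
      then show False using p(3) i eq by simp
    qed
    then have "\<bar>(\<Sum>p\<in>Ev v. g (piece p)) - (f (\<Union>(piece ` Ev v)) - f {})\<bar> \<le> real (card (Ev v) - 1) * \<epsilon>"
      unfolding g_def using pc by (intro weakly_modular_disjoint_union[OF wm] finE) (auto simp: Ev_def)
    \<comment> \<open>Rounding up to the number of incoming edges makes the costs of all right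
      vertices add up to \<open>card E = k * r\<close>.\<close>
    also have "\<dots> \<le> real (card (Ev v)) * \<epsilon>"
      using weakly_modular_nonneg[OF wm] by (intro mult_right_mono) auto
    finally have "(\<Sum>p\<in>Ev v. g (piece p)) \<le> f (\<Union>(piece ` Ev v)) - f {} + real (card (Ev v)) * \<epsilon>"
      by linarith
    moreover have "f (\<Union>(piece ` Ev v)) \<le> M" using pc by (intro M) (auto simp: Ev_def)
    ultimately show ?thesis by linarith
  qed
  have \<phi>E: "\<phi> ` E \<subseteq> {..<m}" using \<phi> unfolding E_def by auto
  have "(\<Sum>j<k. g (A j)) \<le> (\<Sum>j<k. (\<Sum>a<r. g (piece (j, a))) + real (r - 1) * \<epsilon>)"
    by (intro sum_mono split) auto
  also have "\<dots> = (\<Sum>p\<in>E. g (piece p)) + real k * real (r - 1) * \<epsilon>"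
    unfolding E_def by (simp add: sum.distrib sum.cartesian_product)
  also have "(\<Sum>p\<in>E. g (piece p)) = (\<Sum>v<m. \<Sum>p\<in>Ev v. g (piece p))"
    unfolding Ev_def using finE \<phi>E by (intro sum.group[symmetric]) auto
  also have "\<dots> \<le> (\<Sum>v<m. (M - f {}) + real (card (Ev v)) * \<epsilon>)" by (intro sum_mono merge)
  also have "\<dots> = real m * (M - f {}) + real (\<Sum>v<m. card (Ev v)) * \<epsilon>"
    by (simp add: sum.distrib sum_distrib_right)
  also have "(\<Sum>v<m. card (Ev v)) = card E"
    using sum.group[OF finE(1) finite_lessThan \<phi>E, of "\<lambda>_. 1 :: nat"] unfolding Ev_def by simp
  finally show ?thesis unfolding g_def E_def by (simp add: algebra_simps)
qed

text \<open>The weights are rounded down to multiples of \<open>1 / (4 q)\<close>; the error vanishes as \<open>q\<close> grows.\<close>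

lemma weighted_expander_bound:
  fixes w :: "'p \<Rightarrow> real"
  assumes wm: "weakly_modular n \<epsilon> f"
    and M: "\<And>S. S \<subseteq> {1..n} \<Longrightarrow> \<bar>f S\<bar> \<le> M"
    and P: "finite P" and w: "\<And>p. p \<in> P \<Longrightarrow> w p \<ge> 0" "(\<Sum>p\<in>P. w p) = 1"
    and A: "\<And>p. p \<in> P \<Longrightarrow> A p \<subseteq> {1..n}"
    and quarter: "\<And>i. i \<in> {1..n} \<Longrightarrow> (\<Sum>p\<in>P. w p * of_bool (i \<in> A p)) \<le> 1 / 4"
  shows "(\<Sum>p\<in>P. w p * (f (A p) - f {})) \<le> (M - f {}) / 2 + 11 * \<epsilon>"
proof -
  define X where "X = (\<Sum>p\<in>P. w p * (f (A p) - f {}))"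
  \<comment> \<open>This is the expander bound divided by \<open>4 * q\<close>: there are half as
    many right vertices, and cutting and merging cost \<open>5 + 6 = 11\<close> times
    \<open>\<epsilon>\<close> per set.\<close>
  define R where "R = (M - f {}) / 2 + 11 * \<epsilon>"
  have "eventually (\<lambda>q. real q * (4 * (X - R)) \<le> 2 * M * card P) sequentially"
    using eventually_expander_6
  proof eventually_elim
    case (elim q)
    then obtain \<phi> where \<phi>: "\<forall>j<4*q. \<forall>a<6. \<phi> (j, a) < 2*q"
      "\<forall>X\<subseteq>{..<4*q}. card X \<le> q \<longrightarrow> card X \<le> card (\<phi> ` (X \<times> {..<6::nat}))" by blast
    define c where "c p = nat \<lfloor>real (4*q) * w p\<rfloor>" for p
    have c: "real (c p) \<le> real (4*q) * w p" "real (4*q) * w p - real (c p) \<le> 1" if "p \<in> P" for p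
      using w(1)[OF that] unfolding c_def by (auto simp: of_nat_nat) linarith
    define D where "D = Sigma P (\<lambda>p. {..<c p})"
    have cardD: "card (Sigma Q (\<lambda>p. {..<c p})) = (\<Sum>p\<in>Q. c p)" if "Q \<subseteq> P" for Q
      using finite_subset[OF that P] by (simp add: card_SigmaI)
    have finD: "finite D" unfolding D_def using P by auto
    have "real (\<Sum>p\<in>P. c p) \<le> (\<Sum>p\<in>P. real (4*q) * w p)"
      unfolding of_nat_sum by (intro sum_mono c)
    also have "\<dots> = real (4*q)" using w(2) by (simp add: sum_distrib_left[symmetric])
    finally have "(\<Sum>p\<in>P. c p) \<le> 4*q" by (simp only: of_nat_le_iff)
    then have "card D \<le> card {..<4*q}" unfolding D_def by (simp add: cardD)
    then obtain h where h: "h ` D \<subseteq> {..<4*q}" "inj_on h D"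
      using card_le_inj[OF finD finite_lessThan] by blast
    \<comment> \<open>\<open>h\<close> assigns a slot to every copy of every \<open>A p\<close>. The
      remaining slots hold \<open>{}\<close>, which covers no item and contributes
      \<open>f {} - f {} = 0\<close>.\<close>
    define B where "B j = (if j \<in> h ` D then A (fst (inv_into D h j)) else {})" for j
    have Bh: "B (h x) = A (fst x)" if "x \<in> D" for x
      unfolding B_def using that h(2) by simp
    have "(\<Sum>j<4*q. f (B j) - f {}) \<le> real (2*q) * (M - f {})
        + (real (4*q) * real (6 - 1) + real (4*q) * real 6) * \<epsilon>"
    proof (rule expander_bound[OF wm])
      show "f S \<le> M" if "S \<subseteq> {1..n}" for S using M[OF that] by linarith
      show "\<phi> (j, a) < 2*q" if "j < 4*q" "a < 6" for j a using \<phi>(1) that by blast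
      show "card X \<le> card (\<phi> ` (X \<times> {..<6}))" if "X \<subseteq> {..<4*q}" "card X \<le> q" for X
        using \<phi>(2) that by blast
      show "B j \<subseteq> {1..n}" for j
      proof (cases "j \<in> h ` D")
        case True
        then obtain x where x: "x \<in> D" "j = h x" by blast
        have "fst x \<in> P" using x(1) unfolding D_def by auto
        from A[OF this] show ?thesis using Bh[OF x(1)] x(2) by simp
      qed (simp add: B_def)
      show "card {j\<in>{..<4*q}. i \<in> B j} \<le> q" if i: "i \<in> {1..n}" for i
      proof -
        let ?Q = "{p\<in>P. i \<in> A p}"
        have "{j\<in>{..<4*q}. i \<in> B j} \<subseteq> h ` Sigma ?Q (\<lambda>p. {..<c p})"
        proof
          fix j assume j: "j \<in> {j\<in>{..<4*q}. i \<in> B j}"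
          then have "j \<in> h ` D" by (auto simp: B_def split: if_splits)
          then obtain x where x: "x \<in> D" "j = h x" by blast
          then have "x \<in> Sigma ?Q (\<lambda>p. {..<c p})" using j Bh[OF x(1)] unfolding D_def by auto
          with x show "j \<in> h ` Sigma ?Q (\<lambda>p. {..<c p})" by blast
        qed
        then have "card {j\<in>{..<4*q}. i \<in> B j} \<le> card (Sigma ?Q (\<lambda>p. {..<c p}))"
          using P by (intro surj_card_le) auto
        also have "\<dots> = (\<Sum>p\<in>?Q. c p)" by (rule cardD) auto
        finally have "real (card {j\<in>{..<4*q}. i \<in> B j}) \<le> (\<Sum>p\<in>?Q. real (c p))" by (simp flip: of_nat_sum)
        also have "\<dots> \<le> (\<Sum>p\<in>?Q. real (4*q) * w p)" by (intro sum_mono c) auto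
        also have "\<dots> = real (4*q) * (\<Sum>p\<in>P. w p * of_bool (i \<in> A p))"
          using P by (simp add: sum_distrib_left sum.inter_filter of_bool_def if_distrib cong: if_cong)
        \<comment> \<open>The marginal bound 1/4 meets the expansion range here: a quarter of
          \<open>4 * q\<close> slots is \<open>q\<close>.\<close>
        also have "\<dots> \<le> real (4*q) * (1 / 4)" by (intro mult_left_mono quarter i) auto
        finally show ?thesis by simp
      qed
    qed
    also have "(\<Sum>j<4*q. f (B j) - f {}) = (\<Sum>j\<in>h ` D. f (B j) - f {})"
      by (intro sum.mono_neutral_right h) (auto simp: B_def)
    also have "\<dots> = (\<Sum>x\<in>D. f (A (fst x)) - f {})"
      by (subst sum.reindex[OF h(2)]) (auto intro!: sum.cong simp: Bh)
    also have "\<dots> = (\<Sum>p\<in>P. \<Sum>y<c p. f (A p) - f {})"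
      unfolding D_def using P by (subst sum.Sigma) (auto simp: case_prod_beta)
    also have "\<dots> = (\<Sum>p\<in>P. real (c p) * (f (A p) - f {}))" by simp
    moreover have R: "real (4*q) * R = real (2*q) * (M - f {})
        + (real (4*q) * real (6 - 1) + real (4*q) * real 6) * \<epsilon>"
    proof -
      have "real (4*q) * R = real (2*q) * (2 * R)" by simp
      also have "2 * R = (M - f {}) + 22 * \<epsilon>" by (simp add: R_def)
      finally show ?thesis by (simp add: algebra_simps)
    qed
    ultimately have up: "(\<Sum>p\<in>P. real (c p) * (f (A p) - f {})) \<le> real (4*q) * R"
      by (simp only:)
    have "real (4*q) * X - 2 * M * card P = (\<Sum>p\<in>P. real (4*q) * w p * (f (A p) - f {}) - 2 * M)"
      unfolding X_def by (simp add: sum_subtractf sum_distrib_left mult.assoc)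
    also have "\<dots> \<le> (\<Sum>p\<in>P. real (c p) * (f (A p) - f {}))"
    proof (rule sum_mono)
      fix p assume p: "p \<in> P"
      \<comment> \<open>Rounding loses less than one copy's worth of weight at each
        \<open>p\<close>, hence at most \<open>2 * M\<close> in value, independently of
        \<open>q\<close>.\<close>
      have "\<bar>(real (4*q) * w p - real (c p)) * (f (A p) - f {})\<bar> \<le> 1 * (2 * M)"
        unfolding abs_mult
      proof (rule mult_mono)
        show "\<bar>f (A p) - f {}\<bar> \<le> 2 * M" using M[OF A[OF p]] M[of "{}"] by auto
      qed (use c[OF p] in auto)
      then show "real (4*q) * w p * (f (A p) - f {}) - 2 * M \<le> real (c p) * (f (A p) - f {})"
        by (simp add: algebra_simps)
    qed
    finally show ?case using up by (simp add: algebra_simps)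
  qed
  \<comment> \<open>If \<open>X > R\<close>, the left side would grow linearly in \<open>q\<close>
    past the fixed rounding error.\<close>
  moreover have "\<not> eventually (\<lambda>q. real q * y \<le> b) sequentially" if "y > 0" for y b :: real
  proof
    assume "eventually (\<lambda>q. real q * y \<le> b) sequentially"
    moreover have "eventually (\<lambda>q. real q > b / y) sequentially"
      by (rule filterlim_real_sequentially[unfolded filterlim_at_top_dense, rule_format])
    ultimately have "eventually (\<lambda>_. False) sequentially"
      by eventually_elim (use that in \<open>simp add: field_simps\<close>)
    then show False by simp
  qed
  ultimately have "\<not> 4 * (X - R) > 0" by blast
  then have "X \<le> R" by simp
  then show ?thesis by (simp only: X_def R_def)
qed

section \<open>LP duality, halving of the distance, and iteration\<close>

text \<open>Gordan's alternative for one vector per pair \<open>(S, T)\<close>. A solution would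
  give coefficients \<open>c\<close> for which \<open>f S - (\<Sum>i\<in>S. c i)\<close> oscillates
  by less than \<open>2 * D\<close>, and centring this function contradicts the assumption. The
  vanishing combination, normalised, is the required distribution on pairs.\<close>

lemma approx_linear_duality:
  assumes "\<not> approx_linear n D f"
  shows "\<exists>w :: nat set \<times> nat set \<Rightarrow> real. let Q = Pow {1..n} \<times> Pow {1..n} in
    (\<forall>p\<in>Q. w p \<ge> 0) \<and> (\<Sum>p\<in>Q. w p) = 1 \<and>
    (\<forall>i\<in>{1..n}. (\<Sum>p\<in>Q. w p * of_bool (i \<in> fst p)) = (\<Sum>p\<in>Q. w p * of_bool (i \<in> snd p))) \<and>
    2 * D \<le> (\<Sum>p\<in>Q. w p * (f (fst p) - f (snd p)))"
proof -
  define Q where "Q = Pow {1..n} \<times> Pow {1..n}"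
  have finQ: "finite Q" unfolding Q_def by simp
  \<comment> \<open>Coordinate 0 is not an item, so it is free to hold the inequality for the values
    of \<open>f\<close>. The vector for \<open>None\<close> is a unit vector there and forces
    \<open>x 0 > 0\<close>, which permits division by \<open>x 0\<close>.\<close>
  define g :: "(nat set \<times> nat set) option \<Rightarrow> nat \<Rightarrow> real" where
    "g b i = (case b of None \<Rightarrow> of_bool (i = 0)
       | Some (S, T) \<Rightarrow> if i = 0 then 2 * D - (f S - f T) else of_bool (i \<in> S) - of_bool (i \<in> T))" for b i
  let ?O = "insert None (Some ` Q)"
  have "\<not> (\<exists>x. \<forall>v\<in>g ` ?O. (\<Sum>i\<in>{0..n}. v i * x i) > 0)"
  proof
    assume "\<exists>x. \<forall>v\<in>g ` ?O. (\<Sum>i\<in>{0..n}. v i * x i) > 0"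
    then obtain x where x: "\<And>b. b \<in> ?O \<Longrightarrow> (\<Sum>i\<in>{0..n}. g b i * x i) > 0" by blast
    have sum0: "(\<Sum>i\<in>{0..n}. h i) = h 0 + (\<Sum>i\<in>{1..n}. h i)" for h :: "nat \<Rightarrow> real"
      by (simp add: sum.atLeast_Suc_atMost)
    have x0: "x 0 > 0" using x[of None] unfolding sum0 by (simp add: g_def)
    define c where "c i = x i / x 0" for i
    define k where "k S = f S - (\<Sum>i\<in>S. c i)" for S
    have kx: "k S * x 0 = f S * x 0 - (\<Sum>i\<in>S. x i)" for S
      using x0 unfolding k_def c_def by (simp add: left_diff_distrib sum_divide_distrib[symmetric])
    have lt: "k S - k T < 2 * D" if ST: "S \<subseteq> {1..n}" "T \<subseteq> {1..n}" for S T
    proof -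
      have sub: "(\<Sum>i\<in>{1..n}. of_bool (i \<in> U) * x i) = (\<Sum>i\<in>U. x i)" if "U \<subseteq> {1..n}" for U
        using that by (intro sum.mono_neutral_cong_right) auto
      have "0 < (\<Sum>i\<in>{0..n}. g (Some (S, T)) i * x i)" using ST by (intro x) (auto simp: Q_def)
      also have "\<dots> = (2 * D - (f S - f T)) * x 0
          + (\<Sum>i\<in>{1..n}. of_bool (i \<in> S) * x i - of_bool (i \<in> T) * x i)"
        unfolding sum0 by (auto simp: g_def left_diff_distrib intro!: sum.cong)
      also have "\<dots> = (2 * D - (f S - f T)) * x 0 + ((\<Sum>i\<in>S. x i) - (\<Sum>i\<in>T. x i))"
        using ST by (simp only: sum_subtractf sub)
      also have "\<dots> = (2 * D - (k S - k T)) * x 0"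
        using kx[of S] kx[of T] by (simp add: left_diff_distrib)
      finally show ?thesis using x0 by (simp add: zero_less_mult_iff)
    qed
    define K where "K = k ` Pow {1..n}"
    have K: "finite K" "K \<noteq> {}" unfolding K_def by auto
    define c0 where "c0 = (Max K + Min K) / 2"
    have "y - y' \<le> 2 * D" if "y \<in> K" "y' \<in> K" for y y'
      using that lt unfolding K_def by (blast intro: less_imp_le)
    then have osc: "Max K - Min K \<le> 2 * D" using K by simp
    have bounds: "Min K \<le> k S" "k S \<le> Max K" if "S \<subseteq> {1..n}" for S
      using K that unfolding K_def by auto
    have "\<bar>k S - c0\<bar> \<le> D" if "S \<subseteq> {1..n}" for S
      using bounds[OF that] osc unfolding c0_def by (simp add: abs_le_iff field_simps)
    then have "\<bar>f S - (c0 + (\<Sum>i\<in>S. c i))\<bar> \<le> D" if "S \<subseteq> {1..n}" for S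
      using that unfolding k_def by (simp add: algebra_simps)
    moreover have "linear_set_fun n (\<lambda>S. c0 + (\<Sum>i\<in>S. c i))"
      unfolding linear_set_fun_def
      by (intro exI[of _ "c(0 := c0)"]) (auto intro!: sum.cong)
    ultimately have "approx_linear n D f"
      unfolding approx_linear_def by (intro exI[of _ "\<lambda>S. c0 + (\<Sum>i\<in>S. c i)"]) blast
    with assms show False ..
  qed
  then obtain z where z: "z \<in> pos_cone (g ` ?O)" "\<And>i. i \<in> {0..n} \<Longrightarrow> z i = 0"
    using gordan_alternative[of "{0..n}" "g ` ?O"] finQ by blast
  then obtain u where u: "\<And>b. b \<in> ?O \<Longrightarrow> u b \<ge> 0" "(\<Sum>b\<in>?O. u b) > 0"
    "\<And>i. z i = (\<Sum>b\<in>?O. u b * g b i)"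
    using pos_cone_weights[of ?O z g] finQ by blast
  have sumO: "(\<Sum>b\<in>?O. h b) = h None + (\<Sum>p\<in>Q. h (Some p))" for h :: "_ \<Rightarrow> real"
    using finQ by (simp add: sum.reindex)
  define W where "W = (\<Sum>p\<in>Q. u (Some p))"
  have height: "u None + (\<Sum>p\<in>Q. u (Some p) * (2 * D - (f (fst p) - f (snd p)))) = 0"
    using z(2)[of 0] unfolding u(3) sumO by (simp add: g_def case_prod_beta)
  \<comment> \<open>If no pair had weight, coordinate 0 would give \<open>u None = 0\<close> too,
    and all weights would vanish.\<close>
  have "W > 0"
  proof (rule ccontr)
    assume "\<not> W > 0"
    then have "W = 0" unfolding W_def using u(1) by (simp add: sum_nonneg antisym not_less)
    then have "\<forall>p\<in>Q. u (Some p) = 0"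
      unfolding W_def using u(1) finQ by (subst (asm) sum_nonneg_eq_0_iff) auto
    then have "u None = 0" using height by simp
    with \<open>W = 0\<close> u(2) show False unfolding sumO W_def by simp
  qed
  show ?thesis unfolding Let_def Q_def[symmetric]
  proof (intro exI[of _ "\<lambda>p. u (Some p) / W"] conjI ballI)
    show "u (Some p) / W \<ge> 0" if "p \<in> Q" for p using u(1) that \<open>W > 0\<close> by simp
    show "(\<Sum>p\<in>Q. u (Some p) / W) = 1"
      using \<open>W > 0\<close> unfolding sum_divide_distrib[symmetric] W_def by simp
    fix i assume i: "i \<in> {1..n}"
    have "(\<Sum>p\<in>Q. u (Some p) * (of_bool (i \<in> fst p) - of_bool (i \<in> snd p))) = 0"
      using z(2)[of i] i unfolding u(3) sumO by (simp add: g_def case_prod_beta)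
    then show "(\<Sum>p\<in>Q. u (Some p) / W * of_bool (i \<in> fst p)) = (\<Sum>p\<in>Q. u (Some p) / W * of_bool (i \<in> snd p))"
      by (simp add: right_diff_distrib sum_subtractf sum_divide_distrib[symmetric])
  next
    have "(\<Sum>p\<in>Q. u (Some p) * (2 * D - (f (fst p) - f (snd p))))
        = W * (2 * D) - (\<Sum>p\<in>Q. u (Some p) * (f (fst p) - f (snd p)))"
      unfolding W_def by (simp add: right_diff_distrib[of _ "2 * D"] sum_subtractf sum_distrib_right)
    \<comment> \<open>The nonnegative weight of \<open>None\<close> is the slack that turns the
      equation in coordinate 0 into an inequality.\<close>
    then have "W * (2 * D) \<le> (\<Sum>p\<in>Q. u (Some p) * (f (fst p) - f (snd p)))"
      using height u(1)[of None] by simp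
    then show "2 * D \<le> (\<Sum>p\<in>Q. u (Some p) / W * (f (fst p) - f (snd p)))"
      using \<open>W > 0\<close> by (simp add: sum_divide_distrib[symmetric] field_simps)
  qed
qed

text \<open>After subtracting a linear function within \<open>M\<close>, the reassembly bound is
  applied to \<open>g\<close> on \<open>S - T\<close> and to \<open>- g\<close> on
  \<open>T - S\<close>. Each costs \<open>11 * \<epsilon>\<close>, and passing to the differences
  costs \<open>2 * \<epsilon>\<close>, so \<open>2 * D \<le> M + 24 * \<epsilon>\<close>, against
  the choice of \<open>D\<close>.\<close>

lemma approx_linear_contraction:
  assumes wm: "weakly_modular n \<epsilon> f" and "approx_linear n M f" and D: "D > M / 2 + 12 * \<epsilon>"
  shows "approx_linear n D f"
proof (rule ccontr)
  assume not: "\<not> approx_linear n D f"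
  obtain l where l: "linear_set_fun n l" "\<And>S. S \<subseteq> {1..n} \<Longrightarrow> \<bar>f S - l S\<bar> \<le> M"
    using assms(2) unfolding approx_linear_def by blast
  then obtain c where c: "\<And>S. S \<subseteq> {1..n} \<Longrightarrow> l S = c 0 + (\<Sum>i\<in>S. c i)"
    unfolding linear_set_fun_def by blast
  define g where "g S = f S - l S" for S
  have gM: "\<bar>g S\<bar> \<le> M" if "S \<subseteq> {1..n}" for S using l(2) that unfolding g_def by blast
  have wg: "weakly_modular n \<epsilon> g"
    unfolding weakly_modular_def
  proof (intro allI impI)
    fix S T assume ST: "S \<subseteq> {1..n} \<and> T \<subseteq> {1..n} \<and> S \<inter> T = {}"
    then have "finite S" "finite T" using finite_subset by blast+
    then have "l S + l T - l (S \<union> T) - l (S \<inter> T) = 0"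
      using ST c[of S] c[of T] c[of "S \<union> T"] c[of "{}"] by (simp add: sum.union_disjoint)
    moreover have "\<bar>f S + f T - f (S \<union> T) - f (S \<inter> T)\<bar> \<le> \<epsilon>"
      using wm ST unfolding weakly_modular_def by blast
    ultimately show "\<bar>g S + g T - g (S \<union> T) - g (S \<inter> T)\<bar> \<le> \<epsilon>" unfolding g_def by simp
  qed
  have "\<not> approx_linear n D g"
  proof
    assume "approx_linear n D g"
    then obtain l' where l': "linear_set_fun n l'" "\<And>S. S \<subseteq> {1..n} \<Longrightarrow> \<bar>g S - l' S\<bar> \<le> D"
      unfolding approx_linear_def by blast
    then obtain c' where c': "\<And>S. S \<subseteq> {1..n} \<Longrightarrow> l' S = c' 0 + (\<Sum>i\<in>S. c' i)"
      unfolding linear_set_fun_def by blast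
    have "linear_set_fun n (\<lambda>S. l S + l' S)"
      unfolding linear_set_fun_def using c c'
      by (intro exI[of _ "\<lambda>i. c i + c' i"]) (simp add: sum.distrib)
    moreover have "\<bar>f S - (l S + l' S)\<bar> \<le> D" if "S \<subseteq> {1..n}" for S
      using l'(2)[OF that] unfolding g_def by (simp add: algebra_simps)
    ultimately show False using not unfolding approx_linear_def by blast
  qed
  define Q where "Q = Pow {1..n} \<times> Pow {1..n}"
  have finQ: "finite Q" unfolding Q_def by simp
  obtain w where w: "\<And>p. p \<in> Q \<Longrightarrow> w p \<ge> 0" "(\<Sum>p\<in>Q. w p) = 1"
    "\<And>i. i \<in> {1..n} \<Longrightarrow> (\<Sum>p\<in>Q. w p * of_bool (i \<in> fst p)) = (\<Sum>p\<in>Q. w p * of_bool (i \<in> snd p))"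
    "2 * D \<le> (\<Sum>p\<in>Q. w p * (g (fst p) - g (snd p)))"
    using approx_linear_duality[OF \<open>\<not> approx_linear n D g\<close>] unfolding Let_def Q_def[symmetric] by blast
  \<comment> \<open>Two independent draws of a pair: only \<open>S\<close> from the first and
    \<open>T\<close> from the second are used below, which makes \<open>S\<close> and
    \<open>T\<close> independent.\<close>
  define ww where "ww = (\<lambda>(p, p'). w p * w p')"
  have prod: "(\<Sum>x\<in>Q \<times> Q. ww x * (h (fst x) * h' (snd x))) = (\<Sum>p\<in>Q. w p * h p) * (\<Sum>p\<in>Q. w p * h' p)"
    for h h' :: "_ \<Rightarrow> real"
    unfolding ww_def sum_product by (simp add: sum.cartesian_product case_prod_beta mult_ac)
  have ww: "\<And>x. x \<in> Q \<times> Q \<Longrightarrow> ww x \<ge> 0" "(\<Sum>x\<in>Q \<times> Q. ww x) = 1"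
    using w(1) prod[of "\<lambda>_. 1" "\<lambda>_. 1"] w(2) by (auto simp: ww_def)
  define A where "A x = fst (fst x) - snd (snd x)" for x :: "(nat set \<times> nat set) \<times> (nat set \<times> nat set)"
  define B where "B x = snd (snd x) - fst (fst x)" for x :: "(nat set \<times> nat set) \<times> (nat set \<times> nat set)"
  have AB: "A x \<subseteq> {1..n}" "B x \<subseteq> {1..n}" if "x \<in> Q \<times> Q" for x
    using that unfolding A_def B_def Q_def by auto
  have quarter: "t * (1 - t) \<le> 1 / 4" for t :: real
    using zero_le_power2[of "t - 1 / 2"] by (simp add: power2_eq_square algebra_simps)
  have compl: "(\<Sum>p\<in>Q. w p * (1 - h p)) = 1 - (\<Sum>p\<in>Q. w p * h p)" for h
    using w(2) by (simp add: right_diff_distrib sum_subtractf)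
  \<comment> \<open>Both marginals of \<open>i\<close> equal the same \<open>t\<close> by duality,
    so independence gives probability \<open>t * (1 - t)\<close>.\<close>
  have margA: "(\<Sum>x\<in>Q \<times> Q. ww x * of_bool (i \<in> A x)) \<le> 1 / 4" if i: "i \<in> {1..n}" for i
  proof -
    have "(\<Sum>x\<in>Q \<times> Q. ww x * of_bool (i \<in> A x))
        = (\<Sum>x\<in>Q \<times> Q. ww x * (of_bool (i \<in> fst (fst x)) * (1 - of_bool (i \<in> snd (snd x)))))"
      unfolding A_def by (intro sum.cong) auto
    also have "\<dots> \<le> 1 / 4"
      unfolding prod[of "\<lambda>p. of_bool (i \<in> fst p)" "\<lambda>p. 1 - of_bool (i \<in> snd p)"] compl w(3)[OF i]
      by (rule quarter)
    finally show ?thesis .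
  qed
  have margB: "(\<Sum>x\<in>Q \<times> Q. ww x * of_bool (i \<in> B x)) \<le> 1 / 4" if i: "i \<in> {1..n}" for i
  proof -
    have "(\<Sum>x\<in>Q \<times> Q. ww x * of_bool (i \<in> B x))
        = (\<Sum>x\<in>Q \<times> Q. ww x * ((1 - of_bool (i \<in> fst (fst x))) * of_bool (i \<in> snd (snd x))))"
      unfolding B_def by (intro sum.cong) auto
    also have "\<dots> \<le> 1 / 4"
      unfolding prod[of "\<lambda>p. 1 - of_bool (i \<in> fst p)" "\<lambda>p. of_bool (i \<in> snd p)"] compl w(3)[OF i]
      using quarter by (simp only: mult.commute)
    finally show ?thesis .
  qed
  have "(\<Sum>x\<in>Q \<times> Q. ww x * (g (A x) - g {})) \<le> (M - g {}) / 2 + 11 * \<epsilon>"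
    using finQ by (intro weighted_expander_bound[OF wg gM] ww AB margA) auto
  moreover have "(\<Sum>x\<in>Q \<times> Q. ww x * (- g (B x) - - g {})) \<le> (M - - g {}) / 2 + 11 * \<epsilon>"
    using finQ gM
    by (intro weighted_expander_bound[OF weakly_modular_uminus[OF wg]] ww AB margB) auto
  moreover have "(\<Sum>x\<in>Q \<times> Q. ww x * (g (A x) - g (B x)))
      = (\<Sum>x\<in>Q \<times> Q. ww x * (g (A x) - g {})) + (\<Sum>x\<in>Q \<times> Q. ww x * (- g (B x) - - g {}))"
    by (simp add: algebra_simps flip: sum.distrib)
  \<comment> \<open>The terms \<open>g {}\<close> cancel between the bounds for \<open>g\<close> and
    \<open>- g\<close>.\<close>
  ultimately have "(\<Sum>x\<in>Q \<times> Q. ww x * (g (A x) - g (B x))) \<le> M + 22 * \<epsilon>"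
    by (simp add: field_simps)
  moreover have "(\<Sum>x\<in>Q \<times> Q. ww x * (g (fst (fst x)) - g (snd (snd x)) - 2 * \<epsilon>))
      \<le> (\<Sum>x\<in>Q \<times> Q. ww x * (g (A x) - g (B x)))"
  proof (intro sum_mono mult_left_mono ww)
    fix x assume x: "x \<in> Q \<times> Q"
    let ?S = "fst (fst x)" and ?T = "snd (snd x)"
    have ST: "?S \<subseteq> {1..n}" "?T \<subseteq> {1..n}" using x unfolding Q_def by auto
    \<comment> \<open>Both sets are split along \<open>?S \<inter> ?T\<close>; subtracting the two
      estimates cancels the common part and \<open>g {}\<close>.\<close>
    have "\<bar>g (?S - ?T) + g (?S \<inter> ?T) - g ((?S - ?T) \<union> (?S \<inter> ?T)) - g {}\<bar> \<le> \<epsilon>"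
      "\<bar>g (?T - ?S) + g (?S \<inter> ?T) - g ((?T - ?S) \<union> (?S \<inter> ?T)) - g {}\<bar> \<le> \<epsilon>"
      using ST by (auto intro!: weakly_modular_disjoint[OF wg])
    moreover have "(?S - ?T) \<union> (?S \<inter> ?T) = ?S" "(?T - ?S) \<union> (?S \<inter> ?T) = ?T" by auto
    ultimately show "g ?S - g ?T - 2 * \<epsilon> \<le> g (A x) - g (B x)" unfolding A_def B_def by simp
  qed
  moreover have "(\<Sum>x\<in>Q \<times> Q. ww x * (g (fst (fst x)) - g (snd (snd x)) - 2 * \<epsilon>))
      = (\<Sum>p\<in>Q. w p * (g (fst p) - g (snd p))) - 2 * \<epsilon>"
    using prod[of "\<lambda>p. g (fst p)" "\<lambda>_. 1"] prod[of "\<lambda>_. 1" "\<lambda>p. g (snd p)"] ww(2) w(2)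
    by (simp add: right_diff_distrib sum_subtractf sum_distrib_right[symmetric])
  ultimately show False using w(4) D by linarith
qed

text \<open>\<open>24 * \<epsilon>\<close> is the fixed point of
  \<open>M \<mapsto> M / 2 + 12 * \<epsilon>\<close>, and the excess over it halves in each round,
  starting from the zero function.\<close>

lemma weak_Kalton_bound_24: "weak_Kalton_bound 24"
  unfolding weak_Kalton_bound_def
proof (intro allI impI)
  fix n f and \<epsilon> :: real
  assume \<epsilon>: "\<epsilon> \<ge> 0" and wm: "weakly_modular n \<epsilon> f"
  define C where "C = Max ((\<lambda>S. \<bar>f S\<bar>) ` Pow {1..n})"
  have C: "\<bar>f S\<bar> \<le> C" if "S \<subseteq> {1..n}" for S
    unfolding C_def using that by (intro Max_ge) auto
  have iter: "approx_linear n (24 * \<epsilon> + C / 2 ^ k) f" for k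
  proof (induction k)
    case 0
    have "linear_set_fun n (\<lambda>_. 0)"
      unfolding linear_set_fun_def by (intro exI[of _ "\<lambda>_. 0"]) simp
    moreover have "\<bar>f S - 0\<bar> \<le> 24 * \<epsilon> + C / 2 ^ 0" if "S \<subseteq> {1..n}" for S
      using C[OF that] \<epsilon> by simp
    ultimately show ?case unfolding approx_linear_def by blast
  next
    case (Suc k)
    show ?case
    \<comment> \<open>The contraction only reaches distances strictly above
      \<open>M / 2 + 12 * \<epsilon>\<close>; closedness supplies the endpoint.\<close>
    proof (rule approx_linear_closed)
      fix d assume "d > 24 * \<epsilon> + C / 2 ^ Suc k"
      then show "approx_linear n d f"
        by (intro approx_linear_contraction[OF wm Suc]) (simp add: field_simps)
    qed
  qed
  show "approx_linear n (24 * \<epsilon>) f"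
  proof (rule approx_linear_closed)
    fix d assume d: "d > 24 * \<epsilon>"
    have "(\<lambda>k. C * (1 / 2) ^ k) \<longlonglongrightarrow> C * 0"
      by (intro tendsto_intros LIMSEQ_power_zero) auto
    then have "eventually (\<lambda>k. C * (1 / 2) ^ k < d - 24 * \<epsilon>) sequentially"
      using d by (intro order_tendstoD) auto
    then obtain k where "C * (1 / 2) ^ k < d - 24 * \<epsilon>"
      by (auto simp: eventually_sequentially)
    then have "24 * \<epsilon> + C / 2 ^ k \<le> d" by (simp add: power_divide)
    then show "approx_linear n d f"
      using iter[of k] unfolding approx_linear_def by (meson order_trans)
  qed
qed

theorem theorem7:
  shows "weak_Kalton_const \<le> 26.8 \<and>
    (\<forall>n \<ge> 2. \<forall>\<epsilon> \<ge> 0. \<forall>f. weakly_modular n \<epsilon> f \<longrightarrow> approx_linear n (26.8 * \<epsilon>) f)"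
proof (intro conjI allI impI)
  show "weak_Kalton_const \<le> 26.8"
    using weak_Kalton_const_least(2)[OF weak_Kalton_bound_24] by simp
next
  fix n f and \<epsilon> :: real
  assume \<epsilon>: "\<epsilon> \<ge> 0" and "weakly_modular n \<epsilon> f"
  then have "approx_linear n (24 * \<epsilon>) f"
    using weak_Kalton_bound_24 unfolding weak_Kalton_bound_def by blast
  moreover have "24 * \<epsilon> \<le> 26.8 * \<epsilon>" using \<epsilon> by simp
  ultimately show "approx_linear n (26.8 * \<epsilon>) f"
    unfolding approx_linear_def by (meson order_trans)
qed

end
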